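(* For $\boldsymbol\theta=(a,\delta)^\top$ with $a\in\mathbb R\setminus\{-1,1\}$ and $\delta>0$, let $f_{\boldsymbol\theta}$ be the generalized spectrum of the strictly stationary (possibly non-causal) Cauchy AR(1) process $Z_t=aZ_{t-1}+\epsilon_t$, $t\in\mathbb Z$, where $\{\epsilon_t\}$ is i.i.d. centered Cauchy with scale parameter $\delta$. Then $\boldsymbol\theta$ is identifiable from the generalized spectrum: if $\boldsymbol\theta=(a,\delta)^\top$ and $\boldsymbol\theta'=(a',\delta')^\top$ are two such parameters with $f_{\boldsymbol\theta}(\lambda;u,v)=f_{\boldsymbol\theta'}(\lambda;u,v)$ for all $\lambda\in[0,2\pi]$ and $(u,v)\in[-\pi,\pi]^2$, then $\boldsymbol\theta=\boldsymbol\theta'$.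
   Context: The generalized spectrum of a strictly stationary process $\{Z_t\}$ is $$f(\lambda;u,v)=\frac1{2\pi}\sum_{\ell=-\infty}^\infty\bigl\{{\rm E}(e^{iuZ_{t+\ell}+ivZ_t})-{\rm E}(e^{iuZ_{t+\ell}}){\rm E}(e^{ivZ_t})\bigr\}e^{-i\ell\lambda},\quad\lambda\in\mathbb R,\ (u,v)\in\mathbb R^2.$$ A centered Cauchy variable with scale parameter $\delta>0$ has characteristic function $s\mapsto e^{-\delta|s|}$. The strictly stationary AR(1) process is $Z_t=\sum_{j=0}^\infty a^j\epsilon_{t-j}$ if $|a|<1$ (causal case) and $Z_t=-\sum_{j=1}^\infty a^{-j}\epsilon_{t+j}$ if $|a|>1$ (non-causal case). *)

theory Defs
  imports "HOL-Probability.Probability"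
begin

definition strictly_stationary :: "'a measure \<Rightarrow> (int \<Rightarrow> 'a \<Rightarrow> real) \<Rightarrow> bool" where
  "strictly_stationary M Z \<longleftrightarrow>
     (\<forall>t. Z t \<in> borel_measurable M) \<and>
     (\<forall>J h. finite J \<longrightarrow>
        distr M (\<Pi>\<^sub>M j\<in>J. borel) (\<lambda>\<omega>. \<lambda>j\<in>J. Z (j + h) \<omega>) =
        distr M (\<Pi>\<^sub>M j\<in>J. borel) (\<lambda>\<omega>. \<lambda>j\<in>J. Z j \<omega>))"

definition gen_autocov ::
    "'a measure \<Rightarrow> (int \<Rightarrow> 'a \<Rightarrow> real) \<Rightarrow> int \<Rightarrow> int \<Rightarrow> real \<Rightarrow> real \<Rightarrow> complex" where
  "gen_autocov M Z t l u v =
     (LINT \<omega>|M. exp (\<i> * u * Z (t + l) \<omega> + \<i> * v * Z t \<omega>)) -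
     (LINT \<omega>|M. exp (\<i> * u * Z (t + l) \<omega>)) * (LINT \<omega>|M. exp (\<i> * v * Z t \<omega>))"

text \<open>The spectrum is read off at time \<open>t = 0\<close>; for a strictly stationary process
  the choice of \<open>t\<close> is immaterial (\<open>gen_autocov_time_shift\<close> below).\<close>

definition gen_spectrum ::
    "'a measure \<Rightarrow> (int \<Rightarrow> 'a \<Rightarrow> real) \<Rightarrow> real \<Rightarrow> real \<Rightarrow> real \<Rightarrow> complex" where
  "gen_spectrum M Z lam u v =
     1 / (2 * pi) * (\<Sum>\<^sub>\<infinity>l\<in>UNIV. gen_autocov M Z 0 l u v * exp (- \<i> * of_int l * lam))"

lemma gen_autocov_time_shift:
  assumes "strictly_stationary M Z"
  shows "gen_autocov M Z t l u v = gen_autocov M Z 0 l u v"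
proof -
  have meas: "Z s \<in> borel_measurable M" for s
    using assms by (simp add: strictly_stationary_def)
  have shift: "(LINT \<omega>|M. g (Z (t + l) \<omega>) (Z t \<omega>)) = (LINT \<omega>|M. g (Z l \<omega>) (Z 0 \<omega>))"
    if "case_prod g \<in> borel_measurable (borel \<Otimes>\<^sub>M borel)"
    for g :: "real \<Rightarrow> real \<Rightarrow> complex"
  proof -
    let ?P = "\<Pi>\<^sub>M j\<in>{l, 0}. (borel :: real measure)"
    let ?X = "\<lambda>s \<omega>. \<lambda>j\<in>{l, 0}. Z (j + s) \<omega>"
    have eq: "distr M ?P (?X t) = distr M ?P (\<lambda>\<omega>. \<lambda>j\<in>{l, 0}. Z j \<omega>)"
    proof -
      have "finite {l, 0}" by simp
      with assms show ?thesis unfolding strictly_stationary_def by (elim conjE allE impE)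
    qed
    have eq': "distr M ?P (?X t) = distr M ?P (?X 0)"
      unfolding eq by (simp only: add_0_right)
    have "(\<lambda>x. (x l, x 0)) \<in> ?P \<rightarrow>\<^sub>M borel \<Otimes>\<^sub>M borel"
      by (intro measurable_Pair measurable_component_singleton) auto
    from measurable_compose[OF this that]
    have g: "(\<lambda>x. g (x l) (x 0)) \<in> borel_measurable ?P" by simp
    have X: "?X s \<in> M \<rightarrow>\<^sub>M ?P" for s
      by (rule measurable_restrict) (rule meas)
    have "(LINT x|distr M ?P (?X s). g (x l) (x 0)) =
        (LINT \<omega>|M. g (Z (l + s) \<omega>) (Z (0 + s) \<omega>))" for s
      by (subst integral_distr[OF X g]) simp
    from this[of t] this[of 0] show ?thesis
      unfolding eq' by (simp add: add.commute[of l t])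
  qed
  have "(LINT \<omega>|M. exp (\<i> * u * Z (t + l) \<omega> + \<i> * v * Z t \<omega>)) =
      (LINT \<omega>|M. exp (\<i> * u * Z l \<omega> + \<i> * v * Z 0 \<omega>))"
    by (rule shift) measurable
  moreover have "(LINT \<omega>|M. exp (\<i> * u * Z (t + l) \<omega>)) = (LINT \<omega>|M. exp (\<i> * u * Z l \<omega>))"
    by (rule shift[where g = "\<lambda>x y. exp (\<i> * u * x)"]) measurable
  moreover have "(LINT \<omega>|M. exp (\<i> * v * Z t \<omega>)) = (LINT \<omega>|M. exp (\<i> * v * Z 0 \<omega>))"
    by (rule shift[where g = "\<lambda>x y. exp (\<i> * v * y)"]) measurable
  ultimately show ?thesis
    by (simp add: gen_autocov_def)
qed

definition centered_cauchy :: "'a measure \<Rightarrow> real \<Rightarrow> ('a \<Rightarrow> real) \<Rightarrow> bool" where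
  "centered_cauchy M \<delta> X \<longleftrightarrow>
     X \<in> borel_measurable M \<and>
     (\<forall>s. char (distr M borel X) s = complex_of_real (exp (- \<delta> * \<bar>s\<bar>)))"

definition iid_cauchy :: "'a measure \<Rightarrow> real \<Rightarrow> (int \<Rightarrow> 'a \<Rightarrow> real) \<Rightarrow> bool" where
  "iid_cauchy M \<delta> \<epsilon> \<longleftrightarrow>
     prob_space M \<and>
     prob_space.indep_vars M (\<lambda>_. borel) \<epsilon> UNIV \<and>
     (\<forall>t. centered_cauchy M \<delta> (\<epsilon> t))"

text \<open>The stationary solution of \<open>Z t = a * Z (t - 1) + \<epsilon> t\<close>, meaningful for
  \<open>\<bar>a\<bar> \<noteq> 1\<close>. In the non-causal case the sum over \<open>j \<ge> 1\<close> is re-indexed by \<open>Suc j\<close>.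
  The value of \<open>suminf\<close> is arbitrary outside the event of convergence, which has
  probability one for i.i.d. Cauchy innovations.\<close>

definition ar1 :: "real \<Rightarrow> (int \<Rightarrow> 'a \<Rightarrow> real) \<Rightarrow> int \<Rightarrow> 'a \<Rightarrow> real" where
  "ar1 a \<epsilon> t \<omega> =
     (if \<bar>a\<bar> < 1 then (\<Sum>j. a ^ j * \<epsilon> (t - int j) \<omega>)
      else - (\<Sum>j. inverse a ^ Suc j * \<epsilon> (t + int (Suc j)) \<omega>))"

lemma ar1_recursion:
  assumes "\<bar>a\<bar> < 1 \<Longrightarrow> summable (\<lambda>j. a ^ j * \<epsilon> (t - 1 - int j) \<omega>)"
    and "\<bar>a\<bar> > 1 \<Longrightarrow> summable (\<lambda>j. inverse a ^ Suc j * \<epsilon> (t + int (Suc j)) \<omega>)"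
    and "\<bar>a\<bar> \<noteq> 1"
  shows "ar1 a \<epsilon> t \<omega> = a * ar1 a \<epsilon> (t - 1) \<omega> + \<epsilon> t \<omega>"
proof (cases "\<bar>a\<bar> < 1")
  case True
  let ?f = "\<lambda>j. a ^ j * \<epsilon> (t - int j) \<omega>"
  have shift: "(\<lambda>j. ?f (Suc j)) = (\<lambda>j. a * (a ^ j * \<epsilon> (t - 1 - int j) \<omega>))"
    by (simp add: fun_eq_iff algebra_simps)
  have s: "summable (\<lambda>j. ?f (Suc j))"
    unfolding shift by (intro summable_mult assms(1) True)
  hence "suminf ?f = (\<Sum>j. ?f (Suc j)) + ?f 0"
    using suminf_split_head[of ?f] summable_Suc_iff[of ?f] by simp
  thus ?thesis
    unfolding shift using True assms(1) by (simp add: ar1_def suminf_mult)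
next
  case False
  hence a: "\<bar>a\<bar> > 1" "a \<noteq> 0" using assms(3) by auto
  let ?f = "\<lambda>j. inverse a ^ j * \<epsilon> (t + int j) \<omega>"
  have s: "summable (\<lambda>j. ?f (Suc j))" using assms(2) a by simp
  hence s': "summable ?f" using summable_Suc_iff[of ?f] by simp
  have shift: "(\<lambda>j. inverse a ^ Suc j * \<epsilon> (t - 1 + int (Suc j)) \<omega>) = (\<lambda>j. inverse a * ?f j)"
    by (simp add: fun_eq_iff algebra_simps)
  have "ar1 a \<epsilon> (t - 1) \<omega> = - (\<Sum>j. inverse a * ?f j)"
    unfolding ar1_def shift using False by simp
  also have "\<dots> = - (inverse a * suminf ?f)"
    using suminf_mult[OF s'] by simp
  also have "suminf ?f = (\<Sum>j. ?f (Suc j)) + ?f 0"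
    using suminf_split_head[OF s'] by simp
  finally have "a * ar1 a \<epsilon> (t - 1) \<omega> = - ((\<Sum>j. ?f (Suc j)) + ?f 0)"
    by (simp only: mult_minus_right mult.assoc[symmetric] right_inverse[OF a(2)] mult_1_left)
  moreover have "ar1 a \<epsilon> t \<omega> = - (\<Sum>j. ?f (Suc j))"
    using False by (simp add: ar1_def)
  ultimately show ?thesis by simp
qed

end

theory Submission imports Defs begin

text \<open>
  Let \<open>b\<close> be \<open>a\<close> in the causal and \<open>1/a\<close> in the non-causal regime, and
  \<open>c = \<delta> / \<bar>1 - \<bar>a\<bar>\<bar>\<close>. The stationary solution is a weighted sum of independent Cauchy
  variables, and linear combinations of such variables are again Cauchy: their scales add up with
  the absolute values of the weights. Collecting the weight of every innovation in
  \<open>u Z\<^sub>t\<^sub>+\<^sub>l + v Z\<^sub>t\<close> gives, in the causal regime and for \<open>l \<ge> 0\<close>, the characteristic function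
  \<open>exp (- c (\<bar>u b\<^sup>l + v\<bar> + \<bar>u\<bar> (1 - \<bar>b\<bar>\<^sup>l)))\<close>, hence an explicit generalized autocovariance
  (\<open>cauchy_ar1_cov\<close>). Up to a sign, which symmetry of the innovations makes
  harmless, a non-causal process is a causal one with coefficient \<open>1/a\<close> run backwards in time, so
  there the formula is the same except that \<open>u\<close> and \<open>v\<close> trade places (\<open>ar1_autocov\<close>).

  These autocovariances decay geometrically in the lag, so the spectrum is an absolutely convergent
  Fourier series and determines each of them (\<open>fourier_coefficients_unique\<close>). Lags zero and one
  then suffice. At lag zero, \<open>(u, v) = (1, -1)\<close> gives \<open>1 - exp (- 2 c)\<close>, hence \<open>c\<close>. At lag one,
  \<open>(1, 1)\<close> and \<open>(1, -1)\<close> give \<open>b\<close>. What remains is to tell \<open>a = b\<close> from \<open>a = 1/b\<close>, that is, to read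
  off the direction of time: the lag one autocovariance is not symmetric in \<open>u\<close> and \<open>v\<close>, as
  \<open>(1, - b)\<close> shows (\<open>cauchy_ar1_cov_asymmetric\<close>). This is where the Cauchy law differs from a
  Gaussian one, whose autoregressions are reversible. Finally \<open>a\<close> and \<open>c\<close> give \<open>\<delta>\<close>.

  The analytic work is to show that the series defining the process converges almost surely although
  Cauchy variables have no mean. It rests on a tail bound drawn from the characteristic function and
  on the Borel--Cantelli lemma (\<open>AE_summable_geometric_cauchy\<close>).
\<close>

section \<open>Tails from the characteristic function\<close>

text \<open>
  Averaging \<open>1 - cos (t X)\<close> over \<open>t \<in> [0, u]\<close> gives \<open>1 - sin (u X) / (u X)\<close>, which is nonnegative and at
  least \<open>1/2\<close> once \<open>\<bar>X\<bar> \<ge> 2 / u\<close>. By Tonelli the mean of that average is the average of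
  \<open>1 - Re \<phi>(t)\<close> with \<open>\<phi>\<close> the characteristic function, so its behaviour near zero controls the tails,
  whether or not \<open>X\<close> has moments.
\<close>

lemma (in prob_space) prob_tail_le_char:
  fixes X :: "'a \<Rightarrow> real"
  assumes X [measurable]: "X \<in> borel_measurable M"
    and bound: "\<And>t. 0 \<le> t \<Longrightarrow> 1 - Re (char (distr M borel X) t) \<le> K * t"
    and "K \<ge> 0" and "u > 0"
  shows "prob {\<omega> \<in> space M. 2 / u \<le> \<bar>X \<omega>\<bar>} \<le> 2 * K * u"
proof -
  interpret P: pair_sigma_finite M lborel ..
  have mean: "(\<integral>\<^sup>+\<omega>. ennreal (1 - cos (t * X \<omega>)) \<partial>M) \<le> ennreal (K * t)" if "t \<ge> 0" for t
  proof -
    have int: "integrable M (\<lambda>\<omega>. cos (t * X \<omega>))"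
      by (rule integrable_const_bound[where B = 1]) auto
    have intc: "integrable M (\<lambda>\<omega>. exp (\<i> * complex_of_real (t * X \<omega>)))"
      by (rule integrable_const_bound[where B = 1]) (auto simp del: of_real_mult)
    have "char (distr M borel X) t = (CLINT \<omega>|M. iexp (t * X \<omega>))"
      unfolding char_def by (subst integral_distr) auto
    hence "Re (char (distr M borel X) t) = (LINT \<omega>|M. Re (iexp (t * X \<omega>)))"
      using integral_Re[OF intc] by simp
    also have "\<dots> = (LINT \<omega>|M. cos (t * X \<omega>))"
      by (simp add: Re_exp del: of_real_mult)
    finally have Re_char: "Re (char (distr M borel X) t) = (LINT \<omega>|M. cos (t * X \<omega>))" .
    have "(\<integral>\<^sup>+\<omega>. ennreal (1 - cos (t * X \<omega>)) \<partial>M) = ennreal (LINT \<omega>|M. 1 - cos (t * X \<omega>))"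
      using int by (intro nn_integral_eq_integral) auto
    also have "(LINT \<omega>|M. 1 - cos (t * X \<omega>)) = 1 - Re (char (distr M borel X) t)"
      using int by (simp add: Re_char prob_space)
    finally show ?thesis
      using bound[OF that] by (simp add: ennreal_leI)
  qed
  have sinc: "ennreal (u / 2 * indicator {\<omega> \<in> space M. 2 / u \<le> \<bar>X \<omega>\<bar>} \<omega>)
      \<le> (\<integral>\<^sup>+t. ennreal (1 - cos (t * X \<omega>)) * indicator {0..u} t \<partial>lborel)" for \<omega>
  proof (cases "2 / u \<le> \<bar>X \<omega>\<bar>")
    case True
    let ?x = "X \<omega>"
    have "?x \<noteq> 0" using True \<open>u > 0\<close> by auto
    have "(\<integral>\<^sup>+t. ennreal (1 - cos (t * ?x)) * indicator {0..u} t \<partial>lborel)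
        = ennreal ((u - sin (u * ?x) / ?x) - (0 - sin (0 * ?x) / ?x))"
      using \<open>u > 0\<close> \<open>?x \<noteq> 0\<close>
      by (intro nn_integral_FTC_Icc) (auto intro!: derivative_eq_intros)
    moreover have "sin (u * ?x) / ?x \<le> u / 2"
    proof -
      have "sin (u * ?x) / ?x \<le> \<bar>sin (u * ?x)\<bar> / \<bar>?x\<bar>"
        by (metis abs_divide abs_ge_self)
      also have "\<dots> \<le> 1 / (2 / u)"
        using True \<open>u > 0\<close> by (intro frac_le) auto
      finally show ?thesis by simp
    qed
    ultimately show ?thesis
      using True by (auto intro!: ennreal_leI split: split_indicator)
  qed auto
  have "ennreal (u / 2) * emeasure M {\<omega> \<in> space M. 2 / u \<le> \<bar>X \<omega>\<bar>}
      = (\<integral>\<^sup>+\<omega>. ennreal (u / 2 * indicator {\<omega> \<in> space M. 2 / u \<le> \<bar>X \<omega>\<bar>} \<omega>) \<partial>M)"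
    using \<open>u > 0\<close>
    by (subst nn_integral_cmult_indicator[symmetric])
       (auto intro!: nn_integral_cong split: split_indicator)
  also have "\<dots> \<le> (\<integral>\<^sup>+\<omega>. \<integral>\<^sup>+t. ennreal (1 - cos (t * X \<omega>)) * indicator {0..u} t \<partial>lborel \<partial>M)"
    by (intro nn_integral_mono sinc)
  also have "\<dots> = (\<integral>\<^sup>+t. \<integral>\<^sup>+\<omega>. ennreal (1 - cos (t * X \<omega>)) * indicator {0..u} t \<partial>M \<partial>lborel)"
    by (rule P.Fubini'[symmetric]) measurable
  also have "\<dots> \<le> (\<integral>\<^sup>+t. ennreal (K * u) * indicator {0..u} t \<partial>lborel)"
  proof (intro nn_integral_mono)
    fix t :: real
    show "(\<integral>\<^sup>+\<omega>. ennreal (1 - cos (t * X \<omega>)) * indicator {0..u} t \<partial>M)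
        \<le> ennreal (K * u) * indicator {0..u} t"
    proof (cases "t \<in> {0..u}")
      case True
      hence "ennreal (K * t) \<le> ennreal (K * u)"
        using \<open>K \<ge> 0\<close> by (intro ennreal_leI mult_left_mono) auto
      with mean[of t] True show ?thesis by (auto intro: order_trans)
    qed auto
  qed
  also have "\<dots> = ennreal (K * u * u)"
    using \<open>u > 0\<close> \<open>K \<ge> 0\<close> by (subst nn_integral_cmult_indicator) (auto simp: ennreal_mult)
  finally have "ennreal (u / 2 * prob {\<omega> \<in> space M. 2 / u \<le> \<bar>X \<omega>\<bar>}) \<le> ennreal (K * u * u)"
    using \<open>u > 0\<close> by (subst ennreal_mult) (simp_all add: emeasure_eq_measure)
  hence "u / 2 * prob {\<omega> \<in> space M. 2 / u \<le> \<bar>X \<omega>\<bar>} \<le> K * u * u"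
    using \<open>u > 0\<close> \<open>K \<ge> 0\<close> by (subst (asm) ennreal_le_iff) auto
  thus ?thesis using \<open>u > 0\<close> by (simp add: field_simps)
qed

section \<open>Series of independent Cauchy variables\<close>

lemma (in prob_space) indep_vars_reindex:
  assumes "inj_on f I" and ind: "indep_vars N X (f ` I)"
  shows "indep_vars (\<lambda>i. N (f i)) (\<lambda>i. X (f i)) I"
  unfolding indep_vars_def2
proof (intro conjI ballI indep_setsI)
  let ?F = "\<lambda>k. {X k -` A \<inter> space M |A. A \<in> sets (N k)}"
  have sets: "indep_sets ?F (f ` I)" and meas: "\<And>k. k \<in> f ` I \<Longrightarrow> X k \<in> M \<rightarrow>\<^sub>M N k"
    using ind by (auto simp: indep_vars_def2)
  show "X (f i) \<in> M \<rightarrow>\<^sub>M N (f i)" if "i \<in> I" for i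
    using meas that by blast
  show "?F (f i) \<subseteq> events" if "i \<in> I" for i
    using meas that by (auto intro: measurable_sets)
  fix A J assume J: "J \<noteq> {}" "J \<subseteq> I" "finite J" and A: "\<forall>j\<in>J. A j \<in> ?F (f j)"
  have inj: "inj_on f J" using assms(1) J(2) by (rule inj_on_subset)
  let ?B = "\<lambda>k. A (the_inv_into J f k)"
  have B: "?B (f j) = A j" if "j \<in> J" for j
    using inj that by (simp add: the_inv_into_f_f)
  have "prob (\<Inter>k\<in>f ` J. ?B k) = (\<Prod>k\<in>f ` J. prob (?B k))"
    by (rule indep_setsD[OF sets]) (use J A B in auto)
  thus "prob (\<Inter>j\<in>J. A j) = (\<Prod>j\<in>J. prob (A j))"
    using B by (simp add: prod.reindex[OF inj] cong: INF_cong_simp)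
qed

lemma centered_cauchy_scale:
  assumes "centered_cauchy M \<delta> X"
  shows "centered_cauchy M (\<bar>c\<bar> * \<delta>) (\<lambda>\<omega>. c * X \<omega>)"
proof -
  have X: "X \<in> borel_measurable M"
    and char: "\<And>s. char (distr M borel X) s = complex_of_real (exp (- \<delta> * \<bar>s\<bar>))"
    using assms by (auto simp: centered_cauchy_def)
  have "char (distr M borel (\<lambda>\<omega>. c * X \<omega>)) s = char (distr M borel X) (c * s)" for s
    using X by (simp add: char_def integral_distr mult_ac)
  thus ?thesis
    using X by (simp add: centered_cauchy_def char abs_mult mult_ac)
qed

text \<open>
  Choose \<open>r\<close> strictly between \<open>\<bar>a\<bar>\<close> and \<open>1\<close>. The events \<open>\<bar>X\<^sub>j\<bar> \<ge> 2 / r\<^sup>j\<close> have probability of order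
  \<open>r\<^sup>j\<close>, so almost surely only finitely many of them occur; outside them the terms are dominated by
  the geometric sequence \<open>2 (\<bar>a\<bar> / r)\<^sup>j\<close>. Since Cauchy variables have no mean, absolute
  convergence in \<open>L\<^sup>1\<close> is not an option.
\<close>

lemma (in prob_space) AE_summable_geometric_cauchy:
  fixes X :: "nat \<Rightarrow> 'a \<Rightarrow> real"
  assumes cauchy: "\<And>j. centered_cauchy M \<delta> (X j)" and "\<delta> > 0" and "\<bar>a\<bar> < 1"
  shows "AE \<omega> in M. summable (\<lambda>j. a ^ j * X j \<omega>)"
proof -
  obtain r where r: "\<bar>a\<bar> < r" "r < 1" using dense[OF \<open>\<bar>a\<bar> < 1\<close>] by blast
  hence "r > 0" by linarith
  define s where "s = \<bar>a\<bar> / r"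
  have s: "0 \<le> s" "s < 1" using r \<open>r > 0\<close> by (auto simp: s_def)
  have X [measurable]: "X j \<in> borel_measurable M" for j
    using cauchy by (auto simp: centered_cauchy_def)
  let ?A = "\<lambda>j. {\<omega> \<in> space M. 2 / r ^ j \<le> \<bar>X j \<omega>\<bar>}"
  have tail: "prob (?A j) \<le> 2 * \<delta> * r ^ j" for j
  proof (rule prob_tail_le_char)
    show "1 - Re (char (distr M borel (X j)) t) \<le> \<delta> * t" if "t \<ge> 0" for t
      using cauchy[of j] that exp_ge_add_one_self[of "- \<delta> * t"] by (simp add: centered_cauchy_def)
  qed (use \<open>\<delta> > 0\<close> \<open>r > 0\<close> in auto)
  have "summable (\<lambda>j. prob (?A j))"
    by (rule summable_comparison_test'[where g = "\<lambda>j. 2 * \<delta> * r ^ j"])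
       (use tail r \<open>r > 0\<close> in \<open>auto intro!: summable_mult summable_geometric\<close>)
  hence "AE \<omega> in M. \<forall>\<^sub>F j in sequentially. \<omega> \<in> space M - ?A j"
    by (intro borel_cantelli_AE1) (auto simp: emeasure_eq_measure)
  thus ?thesis
  proof eventually_elim
    case (elim \<omega>)
    hence "\<forall>\<^sub>F j in sequentially. norm (a ^ j * X j \<omega>) \<le> 2 * s ^ j"
    proof eventually_elim
      case (elim j)
      hence "\<bar>X j \<omega>\<bar> \<le> 2 / r ^ j" by auto
      hence "\<bar>a\<bar> ^ j * \<bar>X j \<omega>\<bar> \<le> \<bar>a\<bar> ^ j * (2 / r ^ j)" by (intro mult_left_mono) auto
      thus ?case by (simp add: s_def power_divide abs_mult power_abs mult_ac)
    qed
    thus ?case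
      by (rule summable_comparison_test_ev) (use s in \<open>auto intro!: summable_mult summable_geometric\<close>)
  qed
qed

text \<open>
  For partial sums this is independence together with the multiplicativity of \<open>exp\<close>; the
  unimodular integrands allow passing to the limit by dominated convergence.
\<close>

lemma (in prob_space) expectation_iexp_cauchy_series:
  fixes X :: "nat \<Rightarrow> 'a \<Rightarrow> real" and w :: "nat \<Rightarrow> real"
  assumes ind: "indep_vars (\<lambda>_. borel) X UNIV" and cauchy: "\<And>j. centered_cauchy M \<delta> (X j)"
    and conv: "AE \<omega> in M. (\<lambda>j. w j * X j \<omega>) sums S \<omega>"
    and w: "(\<lambda>j. \<bar>w j\<bar>) sums W" and S: "S \<in> borel_measurable M"
  shows "(CLINT \<omega>|M. iexp (S \<omega>)) = complex_of_real (exp (- \<delta> * W))"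
proof -
  have X [measurable]: "X j \<in> borel_measurable M" for j
    using cauchy by (auto simp: centered_cauchy_def)
  let ?P = "\<lambda>n \<omega>. \<Sum>j<n. w j * X j \<omega>"
  have partial: "(CLINT \<omega>|M. iexp (?P n \<omega>)) = complex_of_real (exp (- \<delta> * (\<Sum>j<n. \<bar>w j\<bar>)))" for n
  proof -
    have "indep_vars (\<lambda>_. borel) (\<lambda>j \<omega>. w j * X j \<omega>) UNIV"
      by (rule indep_vars_compose2[OF ind]) auto
    hence "indep_vars (\<lambda>_. borel) (\<lambda>j \<omega>. w j * X j \<omega>) {..<n}"
      by (rule indep_vars_subset) auto
    hence "char (distr M borel (?P n)) 1 = (\<Prod>j<n. char (distr M borel (\<lambda>\<omega>. w j * X j \<omega>)) 1)"
      by (rule char_distr_sum)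
    also have "\<dots> = (\<Prod>j<n. complex_of_real (exp (- (\<bar>w j\<bar> * \<delta>))))"
      using centered_cauchy_scale[OF cauchy] by (simp add: centered_cauchy_def)
    also have "\<dots> = complex_of_real (exp (\<Sum>j<n. - (\<bar>w j\<bar> * \<delta>)))"
      by (simp add: exp_sum)
    also have "(\<Sum>j<n. - (\<bar>w j\<bar> * \<delta>)) = - \<delta> * (\<Sum>j<n. \<bar>w j\<bar>)"
      by (simp add: sum_negf sum_distrib_left mult.commute)
    also have "char (distr M borel (?P n)) 1 = (CLINT \<omega>|M. iexp (?P n \<omega>))"
      unfolding char_def by (subst integral_distr) (auto simp del: of_real_sum of_real_mult)
    finally show ?thesis .
  qed
  have "(\<lambda>n. CLINT \<omega>|M. iexp (?P n \<omega>)) \<longlonglongrightarrow> (CLINT \<omega>|M. iexp (S \<omega>))"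
  proof (rule integral_dominated_convergence[where w = "\<lambda>_. 1"])
    show "AE \<omega> in M. (\<lambda>n. iexp (?P n \<omega>)) \<longlonglongrightarrow> iexp (S \<omega>)"
      using conv by eventually_elim (auto simp: sums_def simp del: of_real_sum of_real_mult intro!: tendsto_intros)
  qed (use S in \<open>auto simp del: of_real_sum of_real_mult\<close>)
  moreover have "(\<lambda>n. CLINT \<omega>|M. iexp (?P n \<omega>)) \<longlonglongrightarrow> complex_of_real (exp (- \<delta> * W))"
    unfolding partial using w by (auto simp: sums_def intro!: tendsto_intros)
  ultimately show ?thesis by (rule LIMSEQ_unique)
qed

section \<open>Autocovariances of the Cauchy AR(1) process\<close>

lemma iid_cauchy_reindex_scale:
  assumes iid: "iid_cauchy M \<delta> \<epsilon>" and "inj f"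
  shows "iid_cauchy M (\<bar>c\<bar> * \<delta>) (\<lambda>k \<omega>. c * \<epsilon> (f k) \<omega>)"
proof -
  interpret prob_space M using iid by (simp add: iid_cauchy_def)
  have "indep_vars (\<lambda>_. borel) \<epsilon> (f ` UNIV)"
    using iid by (auto simp: iid_cauchy_def intro: indep_vars_subset)
  hence "indep_vars (\<lambda>_. borel) (\<lambda>k. \<epsilon> (f k)) UNIV"
    by (rule indep_vars_reindex[OF \<open>inj f\<close>])
  hence "indep_vars (\<lambda>_. borel) (\<lambda>k \<omega>. c * \<epsilon> (f k) \<omega>) UNIV"
    by (rule indep_vars_compose2) auto
  thus ?thesis
    using iid by (auto simp: iid_cauchy_def intro: centered_cauchy_scale prob_space_axioms)
qed

text \<open>
  Each innovation \<open>\<epsilon>\<^sub>t\<^sub>+\<^sub>l\<^sub>-\<^sub>j\<close> enters \<open>u Z\<^sub>t\<^sub>+\<^sub>l + v Z\<^sub>t\<close> with weight \<open>u a\<^sup>j\<close> if \<open>j < l\<close>, being later than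
  time \<open>t\<close>, and with weight \<open>u a\<^sup>j + v a\<^sup>j\<^sup>-\<^sup>l = (u a\<^sup>l + v) a\<^sup>j\<^sup>-\<^sup>l\<close> otherwise. The two groups of absolute
  weights are geometric and sum to the two terms of the exponent.
\<close>

lemma causal_joint_char:
  assumes iid: "iid_cauchy M \<delta> \<epsilon>" and "\<delta> > 0" and "\<bar>a\<bar> < 1"
  shows "(CLINT \<omega>|M. iexp (u * ar1 a \<epsilon> (t + int l) \<omega> + v * ar1 a \<epsilon> t \<omega>)) =
    complex_of_real (exp (- (\<delta> / (1 - \<bar>a\<bar>)) * (\<bar>u * a ^ l + v\<bar> + \<bar>u\<bar> * (1 - \<bar>a\<bar> ^ l))))"
proof -
  interpret prob_space M using iid by (simp add: iid_cauchy_def)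
  have cauchy: "centered_cauchy M \<delta> (\<epsilon> k)" for k using iid by (simp add: iid_cauchy_def)
  hence meas [measurable]: "\<epsilon> k \<in> borel_measurable M" for k by (simp add: centered_cauchy_def)
  define X where "X = (\<lambda>j. \<epsilon> (t + int l - int j))"
  define w where "w = (\<lambda>j. u * a ^ j + (if l \<le> j then v * a ^ (j - l) else 0))"
  define W where "W = (\<bar>u * a ^ l + v\<bar> + \<bar>u\<bar> * (1 - \<bar>a\<bar> ^ l)) / (1 - \<bar>a\<bar>)"
  have Z: "ar1 a \<epsilon> s \<omega> = (\<Sum>j. a ^ j * \<epsilon> (s - int j) \<omega>)" for s \<omega>
    using \<open>\<bar>a\<bar> < 1\<close> by (simp add: ar1_def)
  have "indep_vars (\<lambda>_. borel) \<epsilon> (range (\<lambda>j. t + int l - int j))"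
    using iid by (auto simp: iid_cauchy_def intro: indep_vars_subset)
  hence ind: "indep_vars (\<lambda>_. borel) X UNIV"
    unfolding X_def by (rule indep_vars_reindex[rotated]) (simp add: inj_on_def)
  have "AE \<omega> in M. summable (\<lambda>j. a ^ j * X j \<omega>)"
    unfolding X_def using cauchy assms by (intro AE_summable_geometric_cauchy) auto
  hence conv: "AE \<omega> in M. (\<lambda>j. w j * X j \<omega>) sums (u * ar1 a \<epsilon> (t + int l) \<omega> + v * ar1 a \<epsilon> t \<omega>)"
  proof eventually_elim
    case (elim \<omega>)
    have later: "(\<lambda>j. u * (a ^ j * X j \<omega>)) sums (u * ar1 a \<epsilon> (t + int l) \<omega>)"
      using elim by (intro sums_mult) (simp add: Z X_def summable_sums)
    have shift: "X (j + l) = \<epsilon> (t - int j)" for j by (simp add: X_def)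
    have "(\<lambda>j. a ^ j * X (j + l) \<omega>) sums ar1 a \<epsilon> t \<omega>"
    proof -
      have "summable (\<lambda>j. a ^ j * X (j + l) \<omega>)"
      proof (cases "a = 0")
        case True
        thus ?thesis by (intro summable_finite[of "{0}"]) auto
      next
        case False
        have "summable (\<lambda>j. a ^ (j + l) * X (j + l) \<omega>)"
          using elim by (rule summable_ignore_initial_segment)
        hence "summable (\<lambda>j. inverse (a ^ l) * (a ^ (j + l) * X (j + l) \<omega>))"
          by (rule summable_mult)
        thus ?thesis using False by (simp add: power_add field_simps)
      qed
      thus ?thesis by (simp add: Z shift summable_sums)
    qed
    hence "(\<lambda>j. v * (a ^ j * X (j + l) \<omega>)) sums (v * ar1 a \<epsilon> t \<omega>)"
      by (rule sums_mult)
    hence "(\<lambda>j. (if l \<le> j then v * a ^ (j - l) else 0) * X j \<omega>) sums (v * ar1 a \<epsilon> t \<omega>)"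
      by (subst sums_zero_iff_shift[symmetric, where n = l]) (auto simp: mult.assoc)
    from sums_add[OF later this] show ?case
      by (simp add: w_def algebra_simps)
  qed
  have "(\<lambda>j. \<bar>w j\<bar>) sums W"
  proof -
    have "(\<lambda>j. \<bar>u * a ^ l + v\<bar> * \<bar>a\<bar> ^ j) sums (\<bar>u * a ^ l + v\<bar> * (1 / (1 - \<bar>a\<bar>)))"
      using \<open>\<bar>a\<bar> < 1\<close> by (intro sums_mult geometric_sums) auto
    also have "(\<lambda>j. \<bar>u * a ^ l + v\<bar> * \<bar>a\<bar> ^ j) = (\<lambda>j. \<bar>w (j + l)\<bar>)"
      by (auto simp: w_def power_add abs_mult[symmetric] power_abs[symmetric] algebra_simps)
    finally have "(\<lambda>j. \<bar>w j\<bar>) sums (\<bar>u * a ^ l + v\<bar> * (1 / (1 - \<bar>a\<bar>)) + (\<Sum>j<l. \<bar>w j\<bar>))"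
      by (rule sums_iff_shift[THEN iffD1])
    also have "(\<Sum>j<l. \<bar>w j\<bar>) = \<bar>u\<bar> * (\<Sum>j<l. \<bar>a\<bar> ^ j)"
      by (simp add: w_def sum_distrib_left abs_mult power_abs)
    also have "(\<Sum>j<l. \<bar>a\<bar> ^ j) = (1 - \<bar>a\<bar> ^ l) / (1 - \<bar>a\<bar>)"
      using \<open>\<bar>a\<bar> < 1\<close> by (simp add: sum_gp_strict)
    finally show ?thesis by (simp add: W_def add_divide_distrib)
  qed
  moreover have "(\<lambda>\<omega>. u * ar1 a \<epsilon> (t + int l) \<omega> + v * ar1 a \<epsilon> t \<omega>) \<in> borel_measurable M"
    unfolding Z by measurable
  ultimately have "(CLINT \<omega>|M. iexp (u * ar1 a \<epsilon> (t + int l) \<omega> + v * ar1 a \<epsilon> t \<omega>)) =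
      complex_of_real (exp (- \<delta> * W))"
    using ind cauchy conv by (intro expectation_iexp_cauchy_series) (auto simp: X_def)
  thus ?thesis by (simp add: W_def)
qed

text \<open>
  The autocovariance at lag \<open>l\<close> of a causal process with coefficient \<open>b\<close> and marginal scale \<open>c\<close>,
  where \<open>u\<close> belongs to the later and \<open>v\<close> to the earlier of the two observations.
\<close>

definition cauchy_ar1_cov :: "real \<Rightarrow> real \<Rightarrow> nat \<Rightarrow> real \<Rightarrow> real \<Rightarrow> real" where
  "cauchy_ar1_cov c b l u v =
     exp (- c * (\<bar>u * b ^ l + v\<bar> + \<bar>u\<bar> * (1 - \<bar>b\<bar> ^ l))) - exp (- c * (\<bar>u\<bar> + \<bar>v\<bar>))"

lemma causal_autocov:
  assumes "iid_cauchy M \<delta> \<epsilon>" and "\<delta> > 0" and "\<bar>a\<bar> < 1"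
  shows "gen_autocov M (ar1 a \<epsilon>) t (int l) u v =
      complex_of_real (cauchy_ar1_cov (\<delta> / (1 - \<bar>a\<bar>)) a l u v)" (is ?later)
    and "gen_autocov M (ar1 a \<epsilon>) t (- int l) u v =
      complex_of_real (cauchy_ar1_cov (\<delta> / (1 - \<bar>a\<bar>)) a l v u)" (is ?earlier)
proof -
  note joint = causal_joint_char[OF assms]
  have marginal: "(CLINT \<omega>|M. exp (\<i> * u * ar1 a \<epsilon> s \<omega>)) =
      complex_of_real (exp (- (\<delta> / (1 - \<bar>a\<bar>)) * \<bar>u\<bar>))" for u s
    using joint[of u s 0 0] by (simp add: mult.assoc)
  have product: "complex_of_real (exp (- c * \<bar>u\<bar>)) * complex_of_real (exp (- c * \<bar>v\<bar>)) =
      complex_of_real (exp (- c * (\<bar>u\<bar> + \<bar>v\<bar>)))" for c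
    by (simp add: distrib_left mult_exp_exp flip: of_real_mult)
  show ?later
    unfolding gen_autocov_def marginal product cauchy_ar1_cov_def of_real_diff
    by (subst joint[symmetric]) (simp add: algebra_simps)
  show ?earlier
    unfolding gen_autocov_def marginal product cauchy_ar1_cov_def of_real_diff
    using joint[of v "t - int l" l u] by (simp add: algebra_simps)
qed

lemma cauchy_ar1_cov_minus: "cauchy_ar1_cov c b l (- u) (- v) = cauchy_ar1_cov c b l u v"
proof -
  have "\<bar>- u * b ^ l + - v\<bar> = \<bar>u * b ^ l + v\<bar>" by (simp add: abs_minus_commute)
  thus ?thesis by (simp add: cauchy_ar1_cov_def)
qed

text \<open>
  The minus sign stays outside the series, rather than being absorbed into the innovations,
  because only then the identity holds for every \<open>\<omega>\<close>: where the series diverges, \<open>suminf\<close> is an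
  unspecified number that need not commute with negation.
\<close>

lemma ar1_noncausal_reflect:
  assumes "\<bar>a\<bar> > 1"
  shows "ar1 a \<epsilon> t \<omega> = - ar1 (inverse a) (\<lambda>k \<omega>. inverse a * \<epsilon> (1 - k) \<omega>) (- t) \<omega>"
proof -
  have "\<bar>inverse a\<bar> < 1" using assms by (simp add: abs_inverse inverse_less_1_iff)
  moreover have "(\<lambda>j. inverse a ^ Suc j * \<epsilon> (t + int (Suc j)) \<omega>)
      = (\<lambda>j. inverse a ^ j * (inverse a * \<epsilon> (1 - (- t - int j)) \<omega>))"
    by (auto simp: algebra_simps)
  ultimately show ?thesis
    using assms by (simp add: ar1_def)
qed

text \<open>
  The coefficient of the process in the direction of time in which it is causal.
\<close>

definition ar1_memory :: "real \<Rightarrow> real" where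
  "ar1_memory a = (if \<bar>a\<bar> < 1 then a else inverse a)"

text \<open>
  The scale of the Cauchy marginal, in either regime.
\<close>

definition ar1_scale :: "real \<Rightarrow> real \<Rightarrow> real" where
  "ar1_scale a \<delta> = \<delta> / \<bar>1 - \<bar>a\<bar>\<bar>"

text \<open>
  Negative lags interchange the later and the earlier observation, and so does the time reversal
  that turns a non-causal process into a causal one. The arguments \<open>u\<close> and \<open>v\<close> are therefore
  swapped exactly when one of the two happens.
\<close>

lemma ar1_autocov:
  assumes "a \<notin> {-1, 1}" and "\<delta> > 0" and iid: "iid_cauchy M \<delta> \<epsilon>"
  shows "gen_autocov M (ar1 a \<epsilon>) 0 l u v = complex_of_real
    (if (0 \<le> l) = (\<bar>a\<bar> < 1)
     then cauchy_ar1_cov (ar1_scale a \<delta>) (ar1_memory a) (nat \<bar>l\<bar>) u v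
     else cauchy_ar1_cov (ar1_scale a \<delta>) (ar1_memory a) (nat \<bar>l\<bar>) v u)"
proof (cases "\<bar>a\<bar> < 1")
  case True
  have "l = int (nat \<bar>l\<bar>) \<or> l = - int (nat \<bar>l\<bar>) \<and> l < 0" by linarith
  moreover have "ar1_scale a \<delta> = \<delta> / (1 - \<bar>a\<bar>)" "ar1_memory a = a"
    using True by (auto simp: ar1_scale_def ar1_memory_def)
  ultimately show ?thesis
    using causal_autocov[OF iid \<open>\<delta> > 0\<close> True, of 0 "nat \<bar>l\<bar>" u v] True by auto
next
  case False
  hence a: "\<bar>a\<bar> > 1" using assms(1) by (auto simp: abs_if split: if_splits)
  let ?b = "inverse a" and ?\<eta> = "\<lambda>k \<omega>. inverse a * \<epsilon> (1 - k) \<omega>"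
  have b: "\<bar>?b\<bar> < 1" using a by (simp add: abs_inverse inverse_less_1_iff)
  have scale: "ar1_scale a \<delta> = \<bar>?b\<bar> * \<delta> / (1 - \<bar>?b\<bar>)" and memory: "ar1_memory a = ?b"
    using a by (auto simp: ar1_scale_def ar1_memory_def abs_inverse field_simps)
  have \<eta>: "iid_cauchy M (\<bar>?b\<bar> * \<delta>) ?\<eta>"
    by (rule iid_cauchy_reindex_scale[OF iid]) (simp add: inj_def)
  have pos: "\<bar>?b\<bar> * \<delta> > 0" using a \<open>\<delta> > 0\<close> by auto
  \<comment> \<open>Besides reversing the lag, reflection negates the process, which amounts to negating \<open>u\<close> and \<open>v\<close>.\<close>
  have reverse: "gen_autocov M (ar1 a \<epsilon>) 0 l u v = gen_autocov M (ar1 ?b ?\<eta>) 0 (- l) (- u) (- v)"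
    by (simp add: gen_autocov_def ar1_noncausal_reflect[OF a])
  have l: "- l = - int (nat \<bar>l\<bar>) \<and> l \<ge> 0 \<or> - l = int (nat \<bar>l\<bar>) \<and> l < 0" by linarith
  from l show ?thesis
  proof (elim disjE conjE)
    assume "- l = - int (nat \<bar>l\<bar>)" "l \<ge> 0"
    thus ?thesis
      unfolding reverse scale memory using causal_autocov(2)[OF \<eta> pos b, of 0 "nat \<bar>l\<bar>" "- u" "- v"] False
      by (simp add: cauchy_ar1_cov_minus)
  next
    assume "- l = int (nat \<bar>l\<bar>)" "l < 0"
    thus ?thesis
      unfolding reverse scale memory using causal_autocov(1)[OF \<eta> pos b, of 0 "nat \<bar>l\<bar>" "- u" "- v"] False
      by (simp add: cauchy_ar1_cov_minus)
  qed
qed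

lemma ar1_memory_less_1:
  assumes "a \<notin> {-1, 1}"
  shows "\<bar>ar1_memory a\<bar> < 1"
proof -
  have "\<bar>a\<bar> \<noteq> 1" using assms by (auto simp: abs_if)
  thus ?thesis by (auto simp: ar1_memory_def abs_inverse inverse_less_1_iff)
qed

lemma ar1_scale_pos: "a \<notin> {-1, 1} \<Longrightarrow> \<delta> > 0 \<Longrightarrow> ar1_scale a \<delta> > 0"
  by (auto simp: ar1_scale_def abs_if)

text \<open>
  The map \<open>x \<mapsto> exp (- x)\<close> is 1-Lipschitz on the nonnegative reals, so it suffices that the
  two exponents differ by at most a multiple of \<open>\<bar>b\<bar>\<^sup>l\<close>.
\<close>

lemma abs_cauchy_ar1_cov_le:
  assumes "c \<ge> 0" and "\<bar>b\<bar> \<le> 1"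
  shows "\<bar>cauchy_ar1_cov c b l u v\<bar> \<le> 2 * c * \<bar>u\<bar> * \<bar>b\<bar> ^ l"
proof -
  let ?p = "\<bar>u * b ^ l + v\<bar> + \<bar>u\<bar> * (1 - \<bar>b\<bar> ^ l)" and ?q = "\<bar>u\<bar> + \<bar>v\<bar>"
  have lip: "\<bar>exp (- x) - exp (- y)\<bar> \<le> \<bar>x - y\<bar>" if xy: "x \<ge> 0" "y \<ge> 0" for x y :: real
  proof -
    have *: "exp (- x) - exp (- y) \<le> y - x" if "0 \<le> x" "x \<le> y" for x y :: real
    proof -
      have "exp (- x) - exp (- y) = exp (- x) * (1 - exp (- (y - x)))"
        by (simp add: algebra_simps flip: exp_add)
      also have "1 - exp (- (y - x)) \<le> y - x"
        using exp_ge_add_one_self[of "- (y - x)"] by linarith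
      hence "exp (- x) * (1 - exp (- (y - x))) \<le> 1 * (y - x)"
        using that by (intro mult_mono) auto
      finally show ?thesis by simp
    qed
    show ?thesis
      using *[of x y] *[of y x] xy by (cases "x \<le> y") (auto simp: abs_if)
  qed
  have "\<bar>b\<bar> ^ l \<le> 1" using assms(2) by (intro power_le_one) auto
  hence "\<bar>cauchy_ar1_cov c b l u v\<bar> \<le> \<bar>c * ?p - c * ?q\<bar>"
    unfolding cauchy_ar1_cov_def mult_minus_left using assms(1) by (intro lip) auto
  also have "\<dots> = c * \<bar>?p - ?q\<bar>"
    using assms(1) by (simp add: abs_mult flip: right_diff_distrib)
  also have "\<bar>?p - ?q\<bar> \<le> 2 * (\<bar>u\<bar> * \<bar>b\<bar> ^ l)"
  proof -
    have "\<bar>\<bar>u * b ^ l + v\<bar> - \<bar>v\<bar>\<bar> \<le> \<bar>u * b ^ l\<bar>" by arith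
    also have "\<dots> = \<bar>u\<bar> * \<bar>b\<bar> ^ l" by (simp add: abs_mult power_abs)
    finally show ?thesis by (simp add: right_diff_distrib)
  qed
  finally show ?thesis using assms(1) by (simp add: mult_left_mono mult.assoc mult.left_commute)
qed

lemma summable_on_ar1_autocov:
  assumes "a \<notin> {-1, 1}" and "\<delta> > 0" and "iid_cauchy M \<delta> \<epsilon>"
  shows "(\<lambda>l. norm (gen_autocov M (ar1 a \<epsilon>) 0 l u v)) summable_on UNIV"
proof -
  let ?b = "ar1_memory a" and ?c = "ar1_scale a \<delta>"
  define g where "g = (\<lambda>l::int. 2 * ?c * (\<bar>u\<bar> + \<bar>v\<bar>) * \<bar>?b\<bar> ^ nat \<bar>l\<bar>)"
  have b: "\<bar>?b\<bar> < 1" by (rule ar1_memory_less_1[OF assms(1)])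
  have c: "?c > 0" by (rule ar1_scale_pos[OF assms(1,2)])
  have bound: "norm (gen_autocov M (ar1 a \<epsilon>) 0 l u v) \<le> g l" for l
  proof -
    have "2 * ?c * x * \<bar>?b\<bar> ^ nat \<bar>l\<bar> \<le> g l" if "x \<le> \<bar>u\<bar> + \<bar>v\<bar>" for x
      unfolding g_def using that c by (intro mult_right_mono mult_left_mono) auto
    hence "2 * ?c * \<bar>u\<bar> * \<bar>?b\<bar> ^ nat \<bar>l\<bar> \<le> g l" "2 * ?c * \<bar>v\<bar> * \<bar>?b\<bar> ^ nat \<bar>l\<bar> \<le> g l" by auto
    thus ?thesis
      using abs_cauchy_ar1_cov_le[of ?c ?b "nat \<bar>l\<bar>" u v] abs_cauchy_ar1_cov_le[of ?c ?b "nat \<bar>l\<bar>" v u] b c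
      by (auto simp: ar1_autocov[OF assms])
  qed
  have "(\<lambda>n. \<bar>?b\<bar> ^ n) summable_on UNIV"
    using b by (intro norm_summable_imp_summable_on) (auto intro!: summable_geometric)
  hence geo: "(\<lambda>n::nat. 2 * ?c * (\<bar>u\<bar> + \<bar>v\<bar>) * \<bar>?b\<bar> ^ n) summable_on UNIV"
    by (rule summable_on_cmult_right)
  have "g summable_on range int" "g summable_on range (\<lambda>n. - int n)"
    using geo by (subst summable_on_reindex; simp add: inj_def g_def o_def)+
  hence "g summable_on (range int \<union> range (\<lambda>n. - int n))" by (rule summable_on_union)
  also have "range int \<union> range (\<lambda>n. - int n) = UNIV"
    by (auto simp: image_iff) (metis int_cases2)
  finally show ?thesis
    by (rule summable_on_comparison_test) (use bound in auto)
qed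

section \<open>From the spectrum to the autocovariances\<close>

text \<open>
  Absolute summability makes the series converge uniformly, so it may be integrated term by term
  against \<open>exp (\<i> m x)\<close>; orthogonality leaves only the \<open>m\<close>-th coefficient.
\<close>

lemma fourier_coefficients_unique:
  fixes g h :: "int \<Rightarrow> complex"
  assumes g: "(\<lambda>l. norm (g l)) summable_on UNIV" and h: "(\<lambda>l. norm (h l)) summable_on UNIV"
    and eq: "\<And>x. x \<in> {0..2 * pi} \<Longrightarrow>
      (\<Sum>\<^sub>\<infinity>l. g l * exp (- \<i> * of_int l * of_real x)) = (\<Sum>\<^sub>\<infinity>l. h l * exp (- \<i> * of_int l * of_real x))"
  shows "g = h"
proof
  fix m :: int
  define e where "e = (\<lambda>l x. exp (\<i> * of_int (m - l) * of_real x) :: complex)"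
  have e_int: "(e l has_integral (if l = m then of_real (2 * pi) else 0)) {0..2 * pi}" for l
  proof (cases "l = m")
    case True
    thus ?thesis
      using has_integral_const_real[of "1::complex" 0 "2 * pi"] by (simp add: e_def scaleR_conv_of_real)
  next
    case False
    define k where "k = m - l"
    have k: "k \<noteq> 0" using False by (simp add: k_def)
    let ?F = "\<lambda>x::real. exp (\<i> * of_int k * of_real x) / (\<i> * of_int k)"
    have "(e l has_integral (?F (2 * pi) - ?F 0)) {0..2 * pi}"
    proof (rule fundamental_theorem_of_calculus)
      fix x :: real
      show "(?F has_vector_derivative e l x) (at x within {0..2 * pi})"
        unfolding e_def k_def[symmetric] using k
        by (auto intro!: derivative_eq_intros has_vector_derivative_real_field)
    qed auto
    moreover have "exp (\<i> * of_int k * of_real (2 * pi)) = 1"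
      by (subst exp_eq_1) (auto simp: mult_ac)
    ultimately show ?thesis using False by simp
  qed
  have coeff: "((\<lambda>x. \<Sum>\<^sub>\<infinity>l. f l * e l x) has_integral 2 * pi * f m) {0..2 * pi}"
    if f: "(\<lambda>l. norm (f l)) summable_on UNIV" for f :: "int \<Rightarrow> complex"
  proof -
    have "norm (f l * e l x) \<le> norm (f l)" for l x
      by (simp add: e_def norm_mult)
    hence "uniform_limit {0..2 * pi} (\<lambda>X x. \<Sum>l\<in>X. f l * e l x) (\<lambda>x. \<Sum>\<^sub>\<infinity>l. f l * e l x)
        (finite_subsets_at_top UNIV)"
      using f by (intro Weierstrass_m_test_general) auto
    then obtain I J where I: "\<And>X. ((\<lambda>x. \<Sum>l\<in>X. f l * e l x) has_integral I X) {0..2 * pi}"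
      and J: "((\<lambda>x. \<Sum>\<^sub>\<infinity>l. f l * e l x) has_integral J) {0..2 * pi}"
      and lim: "(I \<longlongrightarrow> J) (finite_subsets_at_top UNIV)"
      by (rule uniform_limit_integral) (auto simp: e_def intro!: continuous_intros)
    \<comment> \<open>By orthogonality the integrals are constant as soon as the finite index set contains \<open>m\<close>.\<close>
    have "\<forall>\<^sub>F X in finite_subsets_at_top UNIV. I X = 2 * pi * f m"
      unfolding eventually_finite_subsets_at_top
    proof (intro exI[of _ "{m}"] conjI allI impI)
      fix X :: "int set" assume X: "finite X \<and> {m} \<subseteq> X \<and> X \<subseteq> UNIV"
      have "((\<lambda>x. \<Sum>l\<in>X. f l * e l x) has_integral
          (\<Sum>l\<in>X. f l * (if l = m then of_real (2 * pi) else 0))) {0..2 * pi}"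
        using X by (intro has_integral_sum has_integral_mult_right e_int) auto
      also have "(\<Sum>l\<in>X. f l * (if l = m then of_real (2 * pi) else 0)) = 2 * pi * f m"
        using X by (simp add: if_distrib cong: if_cong)
      finally show "I X = 2 * pi * f m" using I[of X] has_integral_unique by blast
    qed auto
    hence "(I \<longlongrightarrow> 2 * pi * f m) (finite_subsets_at_top UNIV)"
      by (rule tendsto_eventually)
    with lim have "J = 2 * pi * f m"
      by (intro tendsto_unique[OF _ lim]) auto
    with J show ?thesis by simp
  qed
  have twist: "(\<Sum>\<^sub>\<infinity>l. f l * e l x) =
      exp (\<i> * of_int m * of_real x) * (\<Sum>\<^sub>\<infinity>l. f l * exp (- \<i> * of_int l * of_real x))"
    for f :: "int \<Rightarrow> complex" and x :: real
    by (subst infsum_cmult_right'[symmetric])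
       (auto simp: e_def exp_add[symmetric] algebra_simps intro!: infsum_cong)
  have "((\<lambda>x. \<Sum>\<^sub>\<infinity>l. g l * e l x) has_integral 2 * pi * h m) {0..2 * pi}"
    by (rule has_integral_eq[OF _ coeff[OF h]]) (simp only: twist eq)
  from has_integral_unique[OF this coeff[OF g]] show "g m = h m" by simp
qed

lemma gen_autocov_determined_by_spectrum:
  assumes g: "(\<lambda>l. norm (gen_autocov M Z 0 l u v)) summable_on UNIV"
    and h: "(\<lambda>l. norm (gen_autocov M' Z' 0 l u v)) summable_on UNIV"
    and eq: "\<And>x. x \<in> {0..2 * pi} \<Longrightarrow> gen_spectrum M Z x u v = gen_spectrum M' Z' x u v"
  shows "gen_autocov M Z 0 l u v = gen_autocov M' Z' 0 l u v"
  using fourier_coefficients_unique[OF g h] eq by (auto simp: gen_spectrum_def fun_eq_iff)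

section \<open>Parameters from the autocovariances at lags zero and one\<close>

text \<open>
  The subtracted product of the marginal characteristic functions depends only on \<open>\<bar>u\<bar> + \<bar>v\<bar>\<close>,
  so equality of covariances is equality of exponents.
\<close>

lemma cauchy_ar1_cov_lag1_eq_iff:
  assumes "c > 0" and "\<bar>u\<bar> + \<bar>v\<bar> = \<bar>u'\<bar> + \<bar>v'\<bar>"
  shows "cauchy_ar1_cov c b 1 u v = cauchy_ar1_cov c b' 1 u' v' \<longleftrightarrow>
    \<bar>u * b + v\<bar> + \<bar>u\<bar> * (1 - \<bar>b\<bar>) = \<bar>u' * b' + v'\<bar> + \<bar>u'\<bar> * (1 - \<bar>b'\<bar>)"
  using assms by (simp add: cauchy_ar1_cov_def)

text \<open>
  The choice \<open>v = - b u\<close> isolates the innovation \<open>Z\<^sub>t\<^sub>+\<^sub>1 - b Z\<^sub>t\<close>. Its exponent \<open>1 - \<bar>b\<bar>\<close> falls short of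
  the exponent with \<open>u\<close> and \<open>v\<close> swapped by \<open>2 \<bar>b\<bar> (1 - \<bar>b\<bar>)\<close>, so the
  covariance detects the direction of time unless \<open>b = 0\<close>.
\<close>

lemma cauchy_ar1_cov_asymmetric:
  assumes "c > 0" and "0 < \<bar>b\<bar>" and "\<bar>b\<bar> < 1"
  shows "cauchy_ar1_cov c b 1 1 (- b) \<noteq> cauchy_ar1_cov c b 1 (- b) 1"
proof
  assume "cauchy_ar1_cov c b 1 1 (- b) = cauchy_ar1_cov c b 1 (- b) 1"
  hence "1 - \<bar>b\<bar> = \<bar>1 - b * b\<bar> + \<bar>b\<bar> * (1 - \<bar>b\<bar>)"
    using cauchy_ar1_cov_lag1_eq_iff[OF \<open>c > 0\<close>, of 1 "- b" "- b" 1 b b] by simp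
  moreover have "b * b < 1"
    using assms by (metis abs_mult_self_eq abs_mult_less mult_1 )
  ultimately have "\<bar>b\<bar> * (1 - \<bar>b\<bar>) = 0"
    by (simp add: algebra_simps)
  thus False using assms by auto
qed

text \<open>
  The exponents at \<open>(1, 1)\<close> and \<open>(1, -1)\<close> are \<open>2 + b - \<bar>b\<bar>\<close> and \<open>2 - b - \<bar>b\<bar>\<close>; their difference is \<open>2 b\<close>.
\<close>

lemma cauchy_ar1_cov_lag1_memory:
  assumes "c > 0" and "\<bar>b\<bar> < 1" and "\<bar>b'\<bar> < 1"
    and pp: "cauchy_ar1_cov c b 1 1 1 = cauchy_ar1_cov c b' 1 1 1"
    and pm: "cauchy_ar1_cov c b 1 1 (-1) = cauchy_ar1_cov c b' 1 1 (-1)"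
  shows "b = b'"
  using pp pm assms(2,3) cauchy_ar1_cov_lag1_eq_iff[OF \<open>c > 0\<close>, of 1 1 1 1 b b']
    cauchy_ar1_cov_lag1_eq_iff[OF \<open>c > 0\<close>, of 1 "-1" 1 "-1" b b']
  by (simp add: abs_if split: if_splits)

theorem lemma2:
  fixes M :: "'a measure" and M' :: "'b measure"
    and \<epsilon> :: "int \<Rightarrow> 'a \<Rightarrow> real" and \<epsilon>' :: "int \<Rightarrow> 'b \<Rightarrow> real"
    and a \<delta> a' \<delta>' :: real
  assumes "a \<notin> {-1, 1}" and "\<delta> > 0" and "iid_cauchy M \<delta> \<epsilon>"
    and "a' \<notin> {-1, 1}" and "\<delta>' > 0" and "iid_cauchy M' \<delta>' \<epsilon>'"
    and "\<forall>lam\<in>{0..2 * pi}. \<forall>u\<in>{-pi..pi}. \<forall>v\<in>{-pi..pi}.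
           gen_spectrum M (ar1 a \<epsilon>) lam u v = gen_spectrum M' (ar1 a' \<epsilon>') lam u v"
  shows "(a, \<delta>) = (a', \<delta>')"
proof -
  let ?b = "ar1_memory a" and ?b' = "ar1_memory a'"
  let ?c = "ar1_scale a \<delta>" and ?c' = "ar1_scale a' \<delta>'"
  have b: "\<bar>?b\<bar> < 1" "\<bar>?b'\<bar> < 1"
    using assms(1,4) by (auto intro!: ar1_memory_less_1)
  have c: "?c > 0" "?c' > 0"
    using assms by (auto intro!: ar1_scale_pos)
  have cov_eq: "gen_autocov M (ar1 a \<epsilon>) 0 l u v = gen_autocov M' (ar1 a' \<epsilon>') 0 l u v"
    if uv: "\<bar>u\<bar> \<le> 1" "\<bar>v\<bar> \<le> 1" for l u v
  proof (rule gen_autocov_determined_by_spectrum)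
    have "u \<in> {-pi..pi}" "v \<in> {-pi..pi}" using uv pi_ge_two by auto
    thus "gen_spectrum M (ar1 a \<epsilon>) x u v = gen_spectrum M' (ar1 a' \<epsilon>') x u v"
      if "x \<in> {0..2 * pi}" for x
      using assms(7) that by blast
  qed (rule summable_on_ar1_autocov[OF assms(1-3)] summable_on_ar1_autocov[OF assms(4-6)])+
  note autocov = ar1_autocov[OF assms(1-3)] ar1_autocov[OF assms(4-6)]
  have scale: "?c = ?c'"
    using cov_eq[of 1 "-1" 0] unfolding autocov by (simp add: cauchy_ar1_cov_def split: if_splits)
  have lag1: "(if \<bar>a\<bar> < 1 then cauchy_ar1_cov ?c ?b 1 u v else cauchy_ar1_cov ?c ?b 1 v u) =
      (if \<bar>a'\<bar> < 1 then cauchy_ar1_cov ?c ?b' 1 u v else cauchy_ar1_cov ?c ?b' 1 v u)"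
    if "\<bar>u\<bar> \<le> 1" "\<bar>v\<bar> \<le> 1" for u v
  proof -
    have one: "nat \<bar>1\<bar> = 1" "(0::int) \<le> 1" by auto
    show ?thesis
      using cov_eq[OF that, of 1] unfolding autocov scale by (simp only: of_real_eq_iff one simp_thms)
  qed
  have flip: "cauchy_ar1_cov c b 1 (-1) 1 = cauchy_ar1_cov c b 1 1 (-1)" for c b
    using cauchy_ar1_cov_minus[of c b 1 1 "-1"] by simp
  have memory: "?b = ?b'"
  proof (rule cauchy_ar1_cov_lag1_memory[OF c(1) b])
    show "cauchy_ar1_cov ?c ?b 1 1 1 = cauchy_ar1_cov ?c ?b' 1 1 1"
      using lag1[of 1 1] by simp
    show "cauchy_ar1_cov ?c ?b 1 1 (-1) = cauchy_ar1_cov ?c ?b' 1 1 (-1)"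
      using lag1[of 1 "-1"] by (simp only: flip if_cancel abs_one abs_minus_cancel order_refl simp_thms)
  qed
  have regime: "\<bar>a\<bar> < 1 \<longleftrightarrow> \<bar>a'\<bar> < 1"
  proof (rule ccontr)
    assume differ: "\<not> ?thesis"
    \<comment> \<open>One of the two processes is non-causal, and its memory is a reciprocal.\<close>
    hence "?b \<noteq> 0"
      using memory by (auto simp: ar1_memory_def split: if_splits)
    moreover have "cauchy_ar1_cov ?c ?b 1 1 (- ?b) = cauchy_ar1_cov ?c ?b 1 (- ?b) 1"
      using lag1[of 1 "- ?b"] b differ unfolding memory[symmetric] by (auto split: if_splits)
    ultimately show False
      using cauchy_ar1_cov_asymmetric[OF c(1)] b by auto
  qed
  hence "a = a'" using memory by (auto simp: ar1_memory_def split: if_splits)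
  moreover from this have "\<delta> = \<delta>'"
    using scale assms(4) by (auto simp: ar1_scale_def abs_if split: if_splits)
  ultimately show ?thesis by simp
qed

end
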